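(* Suppose a task is answered by $n$ workers and $E[P_{\frac n2}]\ge C$. Let $\bar r$ be the correct answer. Then the probability-based verification model returns $\bar r$ as the result with a probability no less than $C$.
   Context: A task has a finite answer domain $R$ with $|R|=m\ge 2$ and exactly one correct answer $\bar r\in R$. It is answered by $n$ workers $u_1,\dots,u_n$ ($n$ odd), and $f(u_j)\in R$ denotes the answer of worker $u_j$. The accuracy $a_j\in(0,1)$ of $u_j$ is the probability that $u_j$ provides the correct answer; each of the $m-1$ incorrect answers is provided by $u_j$ with equal probability $\frac{1-a_j}{m-1}$. The workers answer independently, and they are randomly drawn, so the accuracies $a_1,\dots,a_n$ are independent and identically distributed random variables with mean $\mu$. A priori every answer in $R$ is equally likely (probability $\frac1m$) to be the correct one. $P_{\frac n2}$ denotes, for given accuracies, the probability that at least $\lceil\frac n2\rceil$ workers provide the correct answer: $$P_{\frac n2}=\sum_{\mathbb U\subseteq\{u_1,\dots,u_n\},\ |\mathbb U|\ge\lceil n/2\rceil}\ \Big(\prod_{u_i\in\mathbb U}a_i\prod_{u_j\notin\mathbb U}(1-a_j)\Big),$$ and its expectation over the accuracies is $E[P_{\frac n2}]=\sum_{k=\lceil n/2\rceil}^{n}\binom nk\mu^k(1-\mu)^{n-k}$. The confidence of worker $u_j$ is $c_j=\ln\frac{(m-1)a_j}{1-a_j}$. Given the observed answers $\Omega=(f(u_1),\dots,f(u_n))$, the confidence of an answer $r\in R$ is $$\rho(r)=P(r\mid\Omega)=\frac{e^{\sum_{f(u_j)=r}c_j}}{\sum_{r_i\in R}e^{\sum_{f(u_j)=r_i}c_j}}.$$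 The probability-based verification model returns the answer with the highest confidence as the result. *)

theory Defs
  imports "HOL-Probability.Probability"
begin

text \<open>
  Workers are indexed by \<open>{1..n}\<close>. An accuracy profile \<open>acc\<close> and an answer profile \<open>ans\<close> give the
  accuracy and the answer of each worker.
\<close>

definition majority_prob :: "nat \<Rightarrow> (nat \<Rightarrow> real) \<Rightarrow> real" where
  "majority_prob n acc =
     (\<Sum>U | U \<subseteq> {1..n} \<and> int (card U) \<ge> \<lceil>real n / 2\<rceil>.
        (\<Prod>i\<in>U. acc i) * (\<Prod>j\<in>{1..n} - U. 1 - acc j))"

definition worker_confidence :: "nat \<Rightarrow> real \<Rightarrow> real" where
  "worker_confidence m \<alpha> = ln ((real m - 1) * \<alpha> / (1 - \<alpha>))"

definition answer_weight ::
    "'r set \<Rightarrow> nat \<Rightarrow> (nat \<Rightarrow> real) \<Rightarrow> (nat \<Rightarrow> 'r) \<Rightarrow> 'r \<Rightarrow> real" where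
  "answer_weight R n acc ans r =
     exp (\<Sum>j | j \<in> {1..n} \<and> ans j = r. worker_confidence (card R) (acc j))"

definition answer_confidence ::
    "'r set \<Rightarrow> nat \<Rightarrow> (nat \<Rightarrow> real) \<Rightarrow> (nat \<Rightarrow> 'r) \<Rightarrow> 'r \<Rightarrow> real" where
  "answer_confidence R n acc ans r =
     answer_weight R n acc ans r / (\<Sum>r'\<in>R. answer_weight R n acc ans r')"

text \<open>
  The sub-\<open>\<sigma>\<close>-algebras of \<open>M\<close> generated by the accuracies and the correct answer, and by the
  accuracies and the workers' answers.
\<close>

definition task_algebra ::
    "'w measure \<Rightarrow> 'r set \<Rightarrow> nat \<Rightarrow> (nat \<Rightarrow> 'w \<Rightarrow> real) \<Rightarrow> ('w \<Rightarrow> 'r) \<Rightarrow> 'w measure" where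
  "task_algebra M R n a rbar =
     vimage_algebra (space M) (\<lambda>\<omega>. (\<lambda>j\<in>{1..n}. a j \<omega>, rbar \<omega>))
       (PiM {1..n} (\<lambda>_. borel) \<Otimes>\<^sub>M count_space R)"

definition observed_algebra ::
    "'w measure \<Rightarrow> 'r set \<Rightarrow> nat \<Rightarrow> (nat \<Rightarrow> 'w \<Rightarrow> real) \<Rightarrow> (nat \<Rightarrow> 'w \<Rightarrow> 'r) \<Rightarrow> 'w measure" where
  "observed_algebra M R n a f =
     vimage_algebra (space M) (\<lambda>\<omega>. (\<lambda>j\<in>{1..n}. a j \<omega>, \<lambda>j\<in>{1..n}. f j \<omega>))
       (PiM {1..n} (\<lambda>_. borel) \<Otimes>\<^sub>M PiM {1..n} (\<lambda>_. count_space R))"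

text \<open>
  The random accuracies are \<open>a j\<close>, the random correct answer is \<open>rbar\<close>, and \<open>f j\<close> is the answer of
  worker \<open>j\<close>. As the accuracies are random themselves, ``the probability that a worker gives a
  certain answer'' is a conditional probability given all accuracies and the correct answer, and
  ``the workers answer independently'' is conditional independence given these. The prior on the
  correct answer is uniform whatever the accuracies are, so \<open>rbar\<close> is independent of them.
\<close>

locale crowd_task = prob_space M for M :: "'w measure" +
  fixes R :: "'r set" and n :: nat and \<mu> :: real
    and a :: "nat \<Rightarrow> 'w \<Rightarrow> real" and rbar :: "'w \<Rightarrow> 'r" and f :: "nat \<Rightarrow> 'w \<Rightarrow> 'r"
  assumes finite_answers: "finite R"
    and two_answers: "card R \<ge> 2"
    and odd_workers: "odd n"
    and accuracy_range: "\<And>j \<omega>. j \<in> {1..n} \<Longrightarrow> \<omega> \<in> space M \<Longrightarrow> 0 < a j \<omega> \<and> a j \<omega> < 1"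
    and accuracy_indep: "indep_vars (\<lambda>_. borel) a {1..n}"
    and accuracy_ident: "\<And>i j. i \<in> {1..n} \<Longrightarrow> j \<in> {1..n} \<Longrightarrow> distr M borel (a i) = distr M borel (a j)"
    and accuracy_mean: "\<And>j. j \<in> {1..n} \<Longrightarrow> expectation (a j) = \<mu>"
    and correct_rv: "random_variable (count_space R) rbar"
    and correct_uniform: "\<And>r. r \<in> R \<Longrightarrow> prob {\<omega> \<in> space M. rbar \<omega> = r} = 1 / real (card R)"
    and correct_indep: "indep_set
      (sets (vimage_algebra (space M) (\<lambda>\<omega>. \<lambda>j\<in>{1..n}. a j \<omega>) (PiM {1..n} (\<lambda>_. borel))))
      (sets (vimage_algebra (space M) rbar (count_space R)))"
    and answer_rv: "\<And>j. j \<in> {1..n} \<Longrightarrow> random_variable (count_space R) (f j)"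
    and answer_law: "\<And>j r. j \<in> {1..n} \<Longrightarrow> r \<in> R \<Longrightarrow>
      AE \<omega> in M.
        real_cond_exp M (task_algebra M R n a rbar) (indicator {\<omega> \<in> space M. f j \<omega> = r}) \<omega>
        = (if r = rbar \<omega> then a j \<omega> else (1 - a j \<omega>) / (real (card R) - 1))"
    and answer_cond_indep: "\<And>w. w \<in> {1..n} \<rightarrow> R \<Longrightarrow>
      AE \<omega> in M.
        real_cond_exp M (task_algebra M R n a rbar) (indicator {\<omega> \<in> space M. \<forall>j\<in>{1..n}. f j \<omega> = w j}) \<omega>
        = (\<Prod>j\<in>{1..n}.
            real_cond_exp M (task_algebra M R n a rbar)
              (indicator {\<omega> \<in> space M. f j \<omega> = w j}) \<omega>)"

text \<open>
  The returned result is an answer of highest confidence. Several answers may attain the maximum;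
  the tie may then be broken by any deterministic or randomised rule that sees only the accuracies
  and the answers. This is the conditional independence of \<open>res\<close> and \<open>rbar\<close> given the accuracies and
  answers. It cannot be dropped: a tie-break that knew \<open>rbar\<close> could always avoid it.
\<close>

locale verification_result = crowd_task M R n \<mu> a rbar f
  for M :: "'w measure" and R :: "'r set" and n \<mu> a rbar f +
  fixes res :: "'w \<Rightarrow> 'r"
  assumes result_rv: "random_variable (count_space R) res"
    and result_highest: "\<And>\<omega>. \<omega> \<in> space M \<Longrightarrow>
      is_arg_max (answer_confidence R n (\<lambda>j. a j \<omega>) (\<lambda>j. f j \<omega>)) (\<lambda>r. r \<in> R) (res \<omega>)"
    and result_cond_indep: "\<And>r r'. r \<in> R \<Longrightarrow> r' \<in> R \<Longrightarrow>
      AE \<omega> in M.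
        real_cond_exp M (observed_algebra M R n a f)
          (indicator {\<omega> \<in> space M. res \<omega> = r \<and> rbar \<omega> = r'}) \<omega>
        = real_cond_exp M (observed_algebra M R n a f) (indicator {\<omega> \<in> space M. res \<omega> = r}) \<omega>
          * real_cond_exp M (observed_algebra M R n a f) (indicator {\<omega> \<in> space M. rbar \<omega> = r'}) \<omega>"

end

theory Submission
  imports Defs
begin

text \<open>
  By Bayes' rule, with a uniform prior, the confidence of an answer is its posterior probability
  given the accuracies and the observed answers. Since the returned answer is conditionally
  independent of the correct one given these, it is correct with probability equal to the expected
  maximal posterior. Since \<open>n\<close> is odd, at most one answer is supported by a majority; the rule that
  returns this answer, if it exists, is correct with probability \<open>E[P\<^bsub>n/2\<^esub>]\<close> and also equal to the
  expected posterior of the answer returned, hence at most the expected maximal posterior.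
\<close>

section \<open>Likelihoods of answer profiles and their relation to the confidence\<close>

text \<open>In the model this is the conditional probability of the answer profile \<open>w\<close>
  when the accuracies are \<open>x\<close> and the correct answer is \<open>r\<close>;
  \<open>m\<close> stands for the number of possible answers.\<close>

definition likelihood :: "nat \<Rightarrow> nat \<Rightarrow> (nat \<Rightarrow> real) \<Rightarrow> (nat \<Rightarrow> 'r) \<Rightarrow> 'r \<Rightarrow> real" where
  "likelihood m n x w r = (\<Prod>j\<in>{1..n}. if w j = r then x j else (1 - x j) / (real m - 1))"

lemma likelihood_cong:
  assumes "\<And>j. j \<in> {1..n} \<Longrightarrow> x j = y j" "\<And>j. j \<in> {1..n} \<Longrightarrow> v j = w j"
  shows "likelihood m n x v r = likelihood m n y w r"
  unfolding likelihood_def using assms by (intro prod.cong) auto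

lemma likelihood_pos:
  assumes "m \<ge> 2" "\<And>j. j \<in> {1..n} \<Longrightarrow> 0 < x j \<and> x j < 1"
  shows "0 < likelihood m n x w r"
  unfolding likelihood_def using assms by (intro prod_pos) auto

lemma likelihood_le_1:
  assumes "m \<ge> 2" "\<And>j. j \<in> {1..n} \<Longrightarrow> 0 < x j \<and> x j < 1"
  shows "likelihood m n x w r \<le> 1"
  unfolding likelihood_def
proof (rule prod_le_1)
  fix j assume "j \<in> {1..n}"
  then have "0 < x j" "x j < 1" "real m - 1 \<ge> 1" using assms by auto
  then show "0 \<le> (if w j = r then x j else (1 - x j) / (real m - 1)) \<and>
      (if w j = r then x j else (1 - x j) / (real m - 1)) \<le> 1"
    by (auto simp: divide_le_eq)
qed

text \<open>The exponential of a worker's confidence is the ratio of the two possible factors of the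
  likelihood, \<open>x j\<close> over \<open>(1 - x j) / (m - 1)\<close>. Dividing the likelihood by
  the factors for all workers being wrong therefore leaves this ratio for the supporters of
  \<open>r\<close> and 1 for everybody else. The divisor is the same for every
  \<open>r\<close>.\<close>

lemma answer_weight_eq_likelihood:
  assumes "card R \<ge> 2" "\<And>j. j \<in> {1..n} \<Longrightarrow> 0 < x j \<and> x j < 1"
  shows "answer_weight R n x w r =
    likelihood (card R) n x w r / (\<Prod>j\<in>{1..n}. (1 - x j) / (real (card R) - 1))"
proof -
  let ?m = "real (card R) - 1"
  have m: "?m > 0" using assms(1) by auto
  have "answer_weight R n x w r = (\<Prod>j | j \<in> {1..n} \<and> w j = r. exp (worker_confidence (card R) (x j)))"
    unfolding answer_weight_def by (simp add: exp_sum)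
  also have "\<dots> = (\<Prod>j\<in>{1..n}. if w j = r then exp (worker_confidence (card R) (x j)) else 1)"
    by (subst prod.inter_filter[symmetric]) auto
  also have "\<dots> = (\<Prod>j\<in>{1..n}. (if w j = r then x j else (1 - x j) / ?m) / ((1 - x j) / ?m))"
  proof (rule prod.cong)
    fix j assume "j \<in> {1..n}"
    then have "0 < x j" "x j < 1" using assms by auto
    then show "(if w j = r then exp (worker_confidence (card R) (x j)) else 1) =
        (if w j = r then x j else (1 - x j) / ?m) / ((1 - x j) / ?m)"
      using m by (auto simp: worker_confidence_def field_simps)
  qed simp
  finally show ?thesis unfolding likelihood_def prod_dividef .
qed

text \<open>The factor between weight and likelihood is common to all answers and cancels in the
  normalisation.\<close>

lemma answer_confidence_eq_likelihood:
  assumes "card R \<ge> 2" "\<And>j. j \<in> {1..n} \<Longrightarrow> 0 < x j \<and> x j < 1"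
  shows "answer_confidence R n x w r =
    likelihood (card R) n x w r / (\<Sum>s\<in>R. likelihood (card R) n x w s)"
proof -
  define P where "P = (\<Prod>j\<in>{1..n}. (1 - x j) / (real (card R) - 1))"
  have "P > 0" unfolding P_def using assms by (intro prod_pos) auto
  moreover have "answer_weight R n x w s = likelihood (card R) n x w s / P" for s
    unfolding P_def using assms by (rule answer_weight_eq_likelihood)
  ultimately show ?thesis
    by (simp add: answer_confidence_def flip: sum_divide_distrib)
qed

section \<open>Total likelihood of the profiles in which an answer has a majority\<close>

text \<open>The profiles in which exactly the workers in \<open>U\<close> support \<open>r\<close>
  form a product set, \<open>{r}\<close> on \<open>U\<close> and \<open>R - {r}\<close> elsewhere,
  so the sum of products becomes a product of sums. For a worker outside \<open>U\<close> the
  \<open>m - 1\<close> wrong answers share the mass \<open>1 - x j\<close> equally.\<close>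

lemma sum_likelihood_supporters:
  assumes "finite R" "card R \<ge> 2" "r \<in> R" "U \<subseteq> {1..n}"
  shows "(\<Sum>w | w \<in> {1..n} \<rightarrow>\<^sub>E R \<and> {j \<in> {1..n}. w j = r} = U. likelihood (card R) n x w r) =
    (\<Prod>j\<in>U. x j) * (\<Prod>j\<in>{1..n} - U. 1 - x j)"
proof -
  let ?q = "\<lambda>j s. if s = r then x j else (1 - x j) / (real (card R) - 1)"
  let ?B = "\<lambda>j. if j \<in> U then {r} else R - {r}"
  have "{w. w \<in> {1..n} \<rightarrow>\<^sub>E R \<and> {j \<in> {1..n}. w j = r} = U} = PiE {1..n} ?B"
  proof (intro set_eqI iffI)
    fix w assume "w \<in> PiE {1..n} ?B"
    then have w: "w \<in> extensional {1..n}"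
      "\<And>j. j \<in> {1..n} \<Longrightarrow> w j \<in> (if j \<in> U then {r} else R - {r})" by (auto simp: PiE_iff)
    then have "\<And>j. j \<in> {1..n} \<Longrightarrow> w j \<in> R \<and> (w j = r \<longleftrightarrow> j \<in> U)"
      using \<open>r \<in> R\<close> by (metis DiffD1 DiffD2 singletonD singletonI)
    then show "w \<in> {w. w \<in> {1..n} \<rightarrow>\<^sub>E R \<and> {j \<in> {1..n}. w j = r} = U}"
      using w(1) \<open>U \<subseteq> {1..n}\<close> by (auto simp: PiE_iff)
  qed (auto simp: PiE_iff)
  then have "(\<Sum>w | w \<in> {1..n} \<rightarrow>\<^sub>E R \<and> {j \<in> {1..n}. w j = r} = U. likelihood (card R) n x w r) =
      (\<Sum>w\<in>PiE {1..n} ?B. \<Prod>j\<in>{1..n}. ?q j (w j))"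
    by (simp add: likelihood_def)
  also have "\<dots> = (\<Prod>j\<in>{1..n}. \<Sum>s\<in>?B j. ?q j s)"
    using assms by (intro prod_sum_PiE[symmetric]) auto
  also have "\<dots> = (\<Prod>j\<in>{1..n}. if j \<in> U then x j else 1 - x j)"
  proof (rule prod.cong)
    fix j
    have "(\<Sum>s\<in>R - {r}. ?q j s) = (\<Sum>s\<in>R - {r}. (1 - x j) / (real (card R) - 1))"
      by (intro sum.cong) auto
    also have "\<dots> = 1 - x j" using assms by (simp add: of_nat_diff)
    finally show "(\<Sum>s\<in>?B j. ?q j s) = (if j \<in> U then x j else 1 - x j)" by simp
  qed simp
  also have "\<dots> = (\<Prod>j\<in>U. x j) * (\<Prod>j\<in>{1..n} - U. 1 - x j)"
  proof -
    have "{1..n} \<inter> {j. j \<in> U} = U" "{1..n} \<inter> - {j. j \<in> U} = {1..n} - U"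
      using \<open>U \<subseteq> {1..n}\<close> by auto
    then show ?thesis by (subst prod.If_cases) simp_all
  qed
  finally show ?thesis .
qed

definition majority :: "nat \<Rightarrow> (nat \<Rightarrow> 'r) \<Rightarrow> 'r \<Rightarrow> bool" where
  "majority n w r \<longleftrightarrow> int (card {j \<in> {1..n}. w j = r}) \<ge> \<lceil>real n / 2\<rceil>"

text \<open>Two different answers have disjoint sets of supporters. If both sets had at least half
  of the \<open>n\<close> workers, twice the rounded-up half would be at most \<open>n\<close>,
  hence equal to \<open>n\<close>, which is odd.\<close>

lemma majority_unique:
  assumes "odd n" "majority n w r" "majority n w s"
  shows "r = s"
proof (rule ccontr)
  assume "r \<noteq> s"
  then have "card {j \<in> {1..n}. w j = r} + card {j \<in> {1..n}. w j = s} =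
      card ({j \<in> {1..n}. w j = r} \<union> {j \<in> {1..n}. w j = s})"
    by (intro card_Un_disjoint[symmetric]) auto
  also have "\<dots> \<le> card {1..n}" by (intro card_mono) auto
  finally have "2 * \<lceil>real n / 2\<rceil> \<le> int n"
    using assms(2,3) by (simp add: majority_def)
  moreover have "real n \<le> real_of_int (2 * \<lceil>real n / 2\<rceil>)"
    using le_of_int_ceiling[of "real n / 2"] unfolding of_int_mult by linarith
  ultimately have "int n = 2 * \<lceil>real n / 2\<rceil>" by linarith
  then show False using \<open>odd n\<close> by (metis dvd_triv_left even_of_nat)
qed

text \<open>Grouping the profiles by the set \<open>U\<close> of supporters of \<open>r\<close>
  turns the sum into the defining sum of \<open>majority_prob\<close>. The value is thus the same
  for every \<open>r\<close>.\<close>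

lemma sum_likelihood_majority:
  assumes "finite R" "card R \<ge> 2" "r \<in> R"
  shows "(\<Sum>w | w \<in> {1..n} \<rightarrow>\<^sub>E R \<and> majority n w r. likelihood (card R) n x w r) = majority_prob n x"
proof -
  let ?S = "{w. w \<in> {1..n} \<rightarrow>\<^sub>E R \<and> majority n w r}"
  let ?T = "{U. U \<subseteq> {1..n} \<and> int (card U) \<ge> \<lceil>real n / 2\<rceil>}"
  let ?g = "\<lambda>w. {j \<in> {1..n}. w j = r}"
  have fin: "finite ({1..n} \<rightarrow>\<^sub>E R)" using assms(1) by (intro finite_PiE) auto
  have "(\<Sum>w\<in>?S. likelihood (card R) n x w r) =
      (\<Sum>U\<in>?T. \<Sum>w | w \<in> ?S \<and> ?g w = U. likelihood (card R) n x w r)"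
    by (rule sum.group[symmetric]) (use fin in \<open>auto simp: majority_def\<close>)
  also have "\<dots> = (\<Sum>U\<in>?T. (\<Prod>j\<in>U. x j) * (\<Prod>j\<in>{1..n} - U. 1 - x j))"
  proof (rule sum.cong)
    fix U assume U: "U \<in> ?T"
    then have "{w. w \<in> ?S \<and> ?g w = U} = {w. w \<in> {1..n} \<rightarrow>\<^sub>E R \<and> ?g w = U}"
      by (auto simp: majority_def)
    then show "(\<Sum>w | w \<in> ?S \<and> ?g w = U. likelihood (card R) n x w r) =
        (\<Prod>j\<in>U. x j) * (\<Prod>j\<in>{1..n} - U. 1 - x j)"
      using sum_likelihood_supporters[OF assms, of U n x] U by simp
  qed simp
  finally show ?thesis by (simp add: majority_prob_def)
qed

section \<open>Measurability and independence of the random data\<close>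

text \<open>The sigma-algebras generated by \<open>X\<close> and \<open>Y\<close> lie inside
  \<open>F\<close> and \<open>G\<close>, and independence passes to smaller families. This turns
  \<open>correct_indep\<close>, a statement about generated algebras, into independence of random
  variables.\<close>

lemma (in prob_space) indep_var_subalgebras:
  assumes indep: "indep_set (sets F) (sets G)" and "space F = space M" "space G = space M"
    and "X \<in> measurable F S" "Y \<in> measurable G T"
    and "random_variable S X" "random_variable T Y"
  shows "indep_var S X T Y"
  unfolding indep_var_eq
proof (intro conjI)
  have "sigma_sets (space M) {X -` A \<inter> space M | A. A \<in> sets S} \<subseteq> sets F"
    using sets_image_in_sets[OF assms(2) assms(4)] by (simp add: sets_vimage_algebra)
  moreover have "sigma_sets (space M) {Y -` A \<inter> space M | A. A \<in> sets T} \<subseteq> sets G"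
    using sets_image_in_sets[OF assms(3) assms(5)] by (simp add: sets_vimage_algebra)
  ultimately show "indep_set (sigma_sets (space M) {X -` A \<inter> space M | A. A \<in> sets S})
      (sigma_sets (space M) {Y -` A \<inter> space M | A. A \<in> sets T})"
    using indep unfolding indep_set_def
    by (elim indep_sets_mono_sets) (auto split: bool.split)
qed fact+

context crowd_task
begin

text \<open>The restriction makes the value a point of the product space, whose elements are
  extensional; it is also the map that generates the algebras of the locale. The same holds for
  \<open>answers\<close>.\<close>

definition accuracies :: "'w \<Rightarrow> nat \<Rightarrow> real" where
  "accuracies \<omega> = (\<lambda>j\<in>{1..n}. a j \<omega>)"

definition answers :: "'w \<Rightarrow> nat \<Rightarrow> 'r" where
  "answers \<omega> = (\<lambda>j\<in>{1..n}. f j \<omega>)"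

abbreviation "acc_space \<equiv> PiM {1..n} (\<lambda>_. borel :: real measure)"
abbreviation "ans_space \<equiv> PiM {1..n} (\<lambda>_. count_space R)"

lemma accuracies_measurable [measurable]: "accuracies \<in> measurable M acc_space"
proof -
  have "\<And>j. j \<in> {1..n} \<Longrightarrow> a j \<in> borel_measurable M"
    using accuracy_indep by (auto simp: indep_vars_def)
  then show ?thesis unfolding accuracies_def by (intro measurable_restrict) auto
qed

lemma answers_measurable [measurable]: "answers \<in> measurable M ans_space"
  unfolding answers_def using answer_rv by (intro measurable_restrict) auto

declare correct_rv [measurable]

lemma rbar_in: "\<omega> \<in> space M \<Longrightarrow> rbar \<omega> \<in> R"
  using measurable_space[OF correct_rv] by simp

lemma answers_in: "\<omega> \<in> space M \<Longrightarrow> answers \<omega> \<in> {1..n} \<rightarrow>\<^sub>E R"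
  using measurable_space[OF answers_measurable] by (simp add: space_PiM)

lemma finite_profiles: "finite ({1..n} \<rightarrow>\<^sub>E R)"
  using finite_answers by (intro finite_PiE) auto

lemma accuracies_range:
  "\<omega> \<in> space M \<Longrightarrow> j \<in> {1..n} \<Longrightarrow> 0 < accuracies \<omega> j \<and> accuracies \<omega> j < 1"
  using accuracy_range[of j \<omega>] by (simp add: accuracies_def)

lemma likelihood_accuracies:
  assumes "\<omega> \<in> space M"
  shows "0 < likelihood (card R) n (accuracies \<omega>) w r" "likelihood (card R) n (accuracies \<omega>) w r \<le> 1"
proof -
  have range: "\<And>j. j \<in> {1..n} \<Longrightarrow> 0 < accuracies \<omega> j \<and> accuracies \<omega> j < 1"
    using accuracies_range[OF assms] .
  show "0 < likelihood (card R) n (accuracies \<omega>) w r"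
    by (rule likelihood_pos[OF two_answers]) (rule range)
  show "likelihood (card R) n (accuracies \<omega>) w r \<le> 1"
    by (rule likelihood_le_1[OF two_answers]) (rule range)
qed

lemma task_subalgebra: "finite_measure_subalgebra M (task_algebra M R n a rbar)"
proof
  have "(\<lambda>\<omega>. (accuracies \<omega>, rbar \<omega>)) \<in> measurable M (acc_space \<Otimes>\<^sub>M count_space R)"
    by measurable
  from sets_image_in_sets[OF refl this]
  show "subalgebra M (task_algebra M R n a rbar)"
    by (simp add: subalgebra_def task_algebra_def accuracies_def)
qed

lemma observed_subalgebra: "finite_measure_subalgebra M (observed_algebra M R n a f)"
proof
  have "(\<lambda>\<omega>. (accuracies \<omega>, answers \<omega>)) \<in> measurable M (acc_space \<Otimes>\<^sub>M ans_space)"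
    by measurable
  from sets_image_in_sets[OF refl this]
  show "subalgebra M (observed_algebra M R n a f)"
    by (simp add: subalgebra_def observed_algebra_def accuracies_def answers_def)
qed

text \<open>Measurability with respect to the small algebra, not merely \<open>M\<close>, is what
  allows functions of the accuracies and the correct answer to be moved through the conditional
  expectation.\<close>

lemma task_measurable:
  "(\<lambda>\<omega>. (accuracies \<omega>, rbar \<omega>)) \<in>
    measurable (task_algebra M R n a rbar) (acc_space \<Otimes>\<^sub>M count_space R)"
  unfolding task_algebra_def accuracies_def
  by (rule measurable_vimage_algebra1) (auto simp: space_pair_measure space_PiM rbar_in)

lemma observed_measurable:
  "(\<lambda>\<omega>. (accuracies \<omega>, answers \<omega>)) \<in>
    measurable (observed_algebra M R n a f) (acc_space \<Otimes>\<^sub>M ans_space)"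
  unfolding observed_algebra_def accuracies_def answers_def
  using measurable_space[OF answer_rv]
  by (intro measurable_vimage_algebra1) (auto simp: space_pair_measure space_PiM)

lemma indep_accuracies_rbar:
  assumes "g \<in> borel_measurable acc_space" "h \<in> borel_measurable (count_space R)"
  shows "indep_var borel (\<lambda>\<omega>. g (accuracies \<omega>) :: real) borel (\<lambda>\<omega>. h (rbar \<omega>) :: real)"
proof (rule indep_var_subalgebras[OF correct_indep])
  have "accuracies \<in> measurable (vimage_algebra (space M) accuracies acc_space) acc_space"
    using measurable_space[OF accuracies_measurable] by (intro measurable_vimage_algebra1) auto
  then show "(\<lambda>\<omega>. g (accuracies \<omega>)) \<in> borel_measurable
      (vimage_algebra (space M) (\<lambda>\<omega>. \<lambda>j\<in>{1..n}. a j \<omega>) acc_space)"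
    using assms(1) unfolding accuracies_def[abs_def] by (rule measurable_compose)
  have "rbar \<in> measurable (vimage_algebra (space M) rbar (count_space R)) (count_space R)"
    using rbar_in by (intro measurable_vimage_algebra1) auto
  then show "(\<lambda>\<omega>. h (rbar \<omega>)) \<in> borel_measurable (vimage_algebra (space M) rbar (count_space R))"
    using assms(2) by (rule measurable_compose)
  show "(\<lambda>\<omega>. g (accuracies \<omega>)) \<in> borel_measurable M" "(\<lambda>\<omega>. h (rbar \<omega>)) \<in> borel_measurable M"
    using assms by measurable
qed simp_all

lemma likelihood_measurable:
  "(\<lambda>p. likelihood m n (fst p) (snd p) r) \<in> borel_measurable (acc_space \<Otimes>\<^sub>M ans_space)"
  unfolding likelihood_def by measurable

lemma likelihood_measurable_fst [measurable]:
  "(\<lambda>x. likelihood m n x w r) \<in> borel_measurable acc_space"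
  unfolding likelihood_def by measurable

text \<open>As \<open>R\<close> is finite, the product of its counting spaces is the counting space
  on the profiles, so singletons are measurable.\<close>

lemma answers_eq_event:
  assumes "w \<in> {1..n} \<rightarrow>\<^sub>E R"
  shows "{\<omega> \<in> space M. answers \<omega> = w} \<in> sets M"
proof -
  have "{w} \<in> sets ans_space"
    using assms finite_answers by (simp add: count_space_PiM_finite countable_finite)
  from measurable_sets[OF answers_measurable this] show ?thesis
    by (simp add: vimage_def Int_def conj_commute)
qed

lemma majority_measurable:
  "(\<lambda>p. majority n (snd p) r) \<in> measurable (acc_space \<Otimes>\<^sub>M ans_space) (count_space UNIV)"
  "(\<lambda>\<omega>. majority n (answers \<omega>) r) \<in> measurable M (count_space UNIV)"
proof -
  have "(\<lambda>w. majority n w r) \<in> measurable ans_space (count_space UNIV)"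
    using finite_answers by (simp add: count_space_PiM_finite countable_finite)
  from measurable_compose[OF measurable_snd this] measurable_compose[OF answers_measurable this]
  show "(\<lambda>p. majority n (snd p) r) \<in> measurable (acc_space \<Otimes>\<^sub>M ans_space) (count_space UNIV)"
    "(\<lambda>\<omega>. majority n (answers \<omega>) r) \<in> measurable M (count_space UNIV)" by auto
qed

section \<open>Joint law of accuracies, answers and correct answer\<close>

text \<open>Given the task algebra, the profile \<open>w\<close> has the likelihood of
  \<open>w\<close> under \<open>rbar\<close> as its conditional probability, by conditional
  independence and the answer law. The remaining factor is measurable for this algebra, so the
  indicator of the profile may be replaced by that likelihood. On \<open>rbar = r\<close> the
  likelihood depends on the accuracies only, which are independent of \<open>rbar\<close>; the
  uniform prior contributes \<open>1 / card R\<close>.\<close>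

lemma expectation_profile:
  assumes g [measurable]: "g \<in> borel_measurable acc_space"
    and bound: "\<And>\<omega>. \<omega> \<in> space M \<Longrightarrow> \<bar>g (accuracies \<omega>)\<bar> \<le> B"
    and w: "w \<in> {1..n} \<rightarrow>\<^sub>E R" and r: "r \<in> R"
  shows "expectation (\<lambda>\<omega>. g (accuracies \<omega>) *
      (indicator {\<omega> \<in> space M. answers \<omega> = w} \<omega> * indicator {\<omega> \<in> space M. rbar \<omega> = r} \<omega>)) =
    expectation (\<lambda>\<omega>. g (accuracies \<omega>) * likelihood (card R) n (accuracies \<omega>) w r) / real (card R)"
proof -
  let ?T = "task_algebra M R n a rbar"
  let ?E = "{\<omega> \<in> space M. answers \<omega> = w}"
  let ?L = "\<lambda>\<omega>. likelihood (card R) n (accuracies \<omega>) w r"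
  let ?h = "\<lambda>\<omega>. g (accuracies \<omega>) * indicator {r} (rbar \<omega>)"
  interpret T: finite_measure_subalgebra M ?T by (rule task_subalgebra)
  have E: "?E = {\<omega> \<in> space M. \<forall>j\<in>{1..n}. f j \<omega> = w j}"
    using w by (auto simp: answers_def fun_eq_iff PiE_iff extensional_def)
  note answers_eq_event[OF w, measurable]
  have ind: "(indicator {r} :: 'r \<Rightarrow> real) \<in> borel_measurable (count_space R)"
    by simp
  have hT: "?h \<in> borel_measurable ?T"
  proof -
    have "(\<lambda>p. g (fst p) * indicator {r} (snd p)) \<in> borel_measurable (acc_space \<Otimes>\<^sub>M count_space R)"
      using measurable_compose[OF measurable_snd ind] by measurable
    from measurable_compose[OF task_measurable this] show ?thesis by simp
  qed
  have hM [measurable]: "?h \<in> borel_measurable M"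
    by (rule measurable_from_subalg[OF T.subalg hT])
  \<comment> \<open>Needed where the indicators vanish and the bound has to dominate 0; any point of
    the space supplies it.\<close>
  have B: "B \<ge> 0" if "\<omega> \<in> space M" for \<omega>
    using bound[OF that] by linarith
  have law: "AE \<omega> in M. real_cond_exp M ?T (indicator ?E) \<omega> =
      (\<Prod>j\<in>{1..n}. if w j = rbar \<omega> then a j \<omega> else (1 - a j \<omega>) / (real (card R) - 1))"
  proof -
    have "AE \<omega> in M. \<forall>j\<in>{1..n}. real_cond_exp M ?T (indicator {\<omega> \<in> space M. f j \<omega> = w j}) \<omega> =
        (if w j = rbar \<omega> then a j \<omega> else (1 - a j \<omega>) / (real (card R) - 1))"
    proof (rule AE_finite_allI)
      fix j assume "j \<in> {1..n}"
      moreover from this have "w j \<in> R" using w by auto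
      ultimately show "AE \<omega> in M. real_cond_exp M ?T (indicator {\<omega> \<in> space M. f j \<omega> = w j}) \<omega> =
          (if w j = rbar \<omega> then a j \<omega> else (1 - a j \<omega>) / (real (card R) - 1))"
        by (rule answer_law)
    qed simp
    moreover have "AE \<omega> in M. real_cond_exp M ?T (indicator ?E) \<omega> =
        (\<Prod>j\<in>{1..n}. real_cond_exp M ?T (indicator {\<omega> \<in> space M. f j \<omega> = w j}) \<omega>)"
      unfolding E using w by (intro answer_cond_indep) auto
    ultimately show ?thesis by eventually_elim simp
  qed
  \<comment> \<open>Where \<open>rbar\<close> differs from \<open>r\<close> both sides are 0 because
    of the indicator in \<open>?h\<close>; elsewhere \<open>rbar\<close> may be replaced by
    \<open>r\<close>.\<close>
  have ae: "AE \<omega> in M. ?h \<omega> * real_cond_exp M ?T (indicator ?E) \<omega> = ?h \<omega> * ?L \<omega>"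
    using law by eventually_elim
      (auto simp: likelihood_def accuracies_def indicator_def intro!: prod.cong)
  have int: "integrable M (\<lambda>\<omega>. ?h \<omega> * indicator ?E \<omega>)"
    by (rule integrable_const_bound[where B=B])
       (auto intro!: AE_I2 simp: abs_mult indicator_def bound B)
  have "expectation (\<lambda>\<omega>. g (accuracies \<omega>) *
      (indicator ?E \<omega> * indicator {\<omega> \<in> space M. rbar \<omega> = r} \<omega>)) =
      expectation (\<lambda>\<omega>. ?h \<omega> * indicator ?E \<omega>)"
    by (intro Bochner_Integration.integral_cong) (auto simp: indicator_def)
  also have "\<dots> = expectation (\<lambda>\<omega>. ?h \<omega> * real_cond_exp M ?T (indicator ?E) \<omega>)"
    by (rule T.real_cond_exp_intg(2)[symmetric]) (use int hT in auto)
  also have "\<dots> = expectation (\<lambda>\<omega>. ?h \<omega> * ?L \<omega>)"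
    by (rule integral_cong_AE) (use ae in auto)
  also have "\<dots> = expectation (\<lambda>\<omega>. (g (accuracies \<omega>) * ?L \<omega>) * indicator {r} (rbar \<omega>))"
    by (simp add: mult_ac)
  also have "\<dots> = expectation (\<lambda>\<omega>. g (accuracies \<omega>) * ?L \<omega>) * expectation (\<lambda>\<omega>. indicator {r} (rbar \<omega>))"
  proof (rule indep_var_lebesgue_integral)
    show "indep_var borel (\<lambda>\<omega>. g (accuracies \<omega>) * ?L \<omega>)
        borel (\<lambda>\<omega>. indicator {r} (rbar \<omega>) :: real)"
      by (rule indep_accuracies_rbar) measurable
    show "integrable M (\<lambda>\<omega>. g (accuracies \<omega>) * ?L \<omega>)"
    proof (rule integrable_const_bound[where B=B])
      have "\<bar>g (accuracies \<omega>)\<bar> * \<bar>?L \<omega>\<bar> \<le> B * 1" if "\<omega> \<in> space M" for \<omega>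
        using that bound[OF that] likelihood_accuracies[OF that, of w r]
        by (intro mult_mono) (auto simp: B)
      then show "AE \<omega> in M. norm (g (accuracies \<omega>) * ?L \<omega>) \<le> B" by (simp add: abs_mult)
    qed measurable
    show "integrable M (\<lambda>\<omega>. indicator {r} (rbar \<omega>) :: real)"
      using measurable_compose[OF correct_rv ind]
      by (intro integrable_const_bound[where B=1]) (auto simp: indicator_def)
  qed
  also have "expectation (\<lambda>\<omega>. indicator {r} (rbar \<omega>)) = prob {\<omega> \<in> space M. rbar \<omega> = r}"
  proof -
    have "expectation (\<lambda>\<omega>. indicator {r} (rbar \<omega>) :: real) =
        expectation (indicator {\<omega> \<in> space M. rbar \<omega> = r})"
      by (intro Bochner_Integration.integral_cong) (auto simp: indicator_def)
    then show ?thesis by simp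
  qed
  finally show ?thesis using correct_uniform[OF r] by simp
qed

text \<open>Splitting by the finitely many values \<open>w\<close> of the answers makes
  \<open>G\<close> a function of the accuracies alone on each piece, so that
  \<open>expectation_profile\<close> applies.\<close>

lemma expectation_correct:
  assumes G [measurable]: "G \<in> borel_measurable (acc_space \<Otimes>\<^sub>M ans_space)"
    and bound: "\<And>\<omega> w. \<omega> \<in> space M \<Longrightarrow> w \<in> {1..n} \<rightarrow>\<^sub>E R \<Longrightarrow> \<bar>G (accuracies \<omega>, w)\<bar> \<le> B"
    and r: "r \<in> R"
  shows "expectation (\<lambda>\<omega>. G (accuracies \<omega>, answers \<omega>) * indicator {\<omega> \<in> space M. rbar \<omega> = r} \<omega>) =
    (\<Sum>w\<in>{1..n} \<rightarrow>\<^sub>E R. expectation (\<lambda>\<omega>. G (accuracies \<omega>, w) * likelihood (card R) n (accuracies \<omega>) w r))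
      / real (card R)"
proof -
  let ?W = "{1..n} \<rightarrow>\<^sub>E R"
  let ?I = "\<lambda>w \<omega>. indicator {\<omega> \<in> space M. answers \<omega> = w} \<omega> * indicator {\<omega> \<in> space M. rbar \<omega> = r} \<omega>"
  have Gw [measurable]: "(\<lambda>x. G (x, w)) \<in> borel_measurable acc_space" if "w \<in> ?W" for w
    by (rule measurable_compose[OF measurable_Pair2' G]) (use that in \<open>simp add: space_PiM\<close>)
  have "expectation (\<lambda>\<omega>. G (accuracies \<omega>, answers \<omega>) * indicator {\<omega> \<in> space M. rbar \<omega> = r} \<omega>) =
      expectation (\<lambda>\<omega>. \<Sum>w\<in>?W. G (accuracies \<omega>, w) * ?I w \<omega>)"
  proof (rule Bochner_Integration.integral_cong)
    fix \<omega> assume \<omega>: "\<omega> \<in> space M"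
    \<comment> \<open>Only the observed profile contributes to the sum.\<close>
    have "(\<Sum>w\<in>?W. G (accuracies \<omega>, w) * ?I w \<omega>) =
        (\<Sum>w\<in>?W. if w = answers \<omega>
          then G (accuracies \<omega>, w) * indicator {\<omega> \<in> space M. rbar \<omega> = r} \<omega> else 0)"
      using \<omega> by (intro sum.cong) (auto simp: indicator_def)
    then show "G (accuracies \<omega>, answers \<omega>) * indicator {\<omega> \<in> space M. rbar \<omega> = r} \<omega> =
        (\<Sum>w\<in>?W. G (accuracies \<omega>, w) * ?I w \<omega>)"
      using answers_in[OF \<omega>] finite_profiles by simp
  qed simp
  also have "\<dots> = (\<Sum>w\<in>?W. expectation (\<lambda>\<omega>. G (accuracies \<omega>, w) * ?I w \<omega>))"
  proof (rule Bochner_Integration.integral_sum)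
    fix w assume w: "w \<in> ?W"
    note [measurable] = Gw[OF w] answers_eq_event[OF w]
    have "\<bar>G (accuracies \<omega>, w)\<bar> * \<bar>?I w \<omega>\<bar> \<le> B" if "\<omega> \<in> space M" for \<omega>
      using bound[OF that w] by (auto simp: indicator_def)
    then show "integrable M (\<lambda>\<omega>. G (accuracies \<omega>, w) * ?I w \<omega>)"
      by (intro integrable_const_bound[where B=B]) (auto simp: abs_mult)
  qed
  also have "\<dots> = (\<Sum>w\<in>?W. expectation (\<lambda>\<omega>. G (accuracies \<omega>, w) *
      likelihood (card R) n (accuracies \<omega>) w r) / real (card R))"
    using Gw bound r by (intro sum.cong refl expectation_profile[where B=B]) auto
  finally show ?thesis by (simp add: sum_divide_distrib)
qed

section \<open>The posterior given accuracies and answers\<close>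

text \<open>Bayes' rule with the uniform prior cancelled. The argument is a pair, so that composing
  with the map that generates \<open>observed_algebra\<close> gives a function measurable for that
  algebra.\<close>

definition posterior :: "'r \<Rightarrow> (nat \<Rightarrow> real) \<times> (nat \<Rightarrow> 'r) \<Rightarrow> real" where
  "posterior r p = likelihood (card R) n (fst p) (snd p) r /
     (\<Sum>s\<in>R. likelihood (card R) n (fst p) (snd p) s)"

lemma posterior_measurable [measurable]:
  "posterior r \<in> borel_measurable (acc_space \<Otimes>\<^sub>M ans_space)"
  unfolding posterior_def using likelihood_measurable by measurable

lemma sum_likelihood_pos:
  assumes "\<omega> \<in> space M"
  shows "(\<Sum>s\<in>R. likelihood (card R) n (accuracies \<omega>) w s) > 0"
  using finite_answers two_answers likelihood_accuracies(1)[OF assms]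
  by (intro sum_pos) auto

lemma posterior_range:
  assumes "\<omega> \<in> space M" "r \<in> R"
  shows "0 \<le> posterior r (accuracies \<omega>, w)" "posterior r (accuracies \<omega>, w) \<le> 1"
proof -
  note pos = likelihood_accuracies(1)[OF assms(1), of w]
  have "likelihood (card R) n (accuracies \<omega>) w r \<le> (\<Sum>s\<in>R. likelihood (card R) n (accuracies \<omega>) w s)"
    using finite_answers assms(2) pos by (intro member_le_sum) (auto intro: less_imp_le)
  then show "0 \<le> posterior r (accuracies \<omega>, w)" "posterior r (accuracies \<omega>, w) \<le> 1"
    using sum_likelihood_pos[OF assms(1), of w] pos[of r] by (auto simp: posterior_def)
qed

lemma posterior_eq_answer_confidence:
  assumes "\<omega> \<in> space M"
  shows "posterior r (accuracies \<omega>, answers \<omega>) = answer_confidence R n (\<lambda>j. a j \<omega>) (\<lambda>j. f j \<omega>) r"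
proof -
  have "likelihood (card R) n (accuracies \<omega>) (answers \<omega>) s =
      likelihood (card R) n (\<lambda>j. a j \<omega>) (\<lambda>j. f j \<omega>) s" for s
    by (rule likelihood_cong) (auto simp: accuracies_def answers_def)
  then show ?thesis
    using accuracy_range[OF _ assms] two_answers
    by (subst answer_confidence_eq_likelihood) (auto simp: posterior_def)
qed

text \<open>This is the defining property of a conditional probability, tested on the observable
  event \<open>T\<close>. After a split by the value of \<open>rbar\<close>, the joint law yields
  likelihoods summed over all possible correct answers; this sum cancels the denominator of
  \<open>posterior\<close> and leaves the likelihood of \<open>r\<close>.\<close>

lemma expectation_posterior:
  assumes T: "T \<in> sets (acc_space \<Otimes>\<^sub>M ans_space)" and r: "r \<in> R"
  shows "expectation (\<lambda>\<omega>. indicator T (accuracies \<omega>, answers \<omega>) *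
      posterior r (accuracies \<omega>, answers \<omega>)) =
    expectation (\<lambda>\<omega>. indicator T (accuracies \<omega>, answers \<omega>) *
      indicator {\<omega> \<in> space M. rbar \<omega> = r} \<omega>)"
proof -
  let ?W = "{1..n} \<rightarrow>\<^sub>E R"
  let ?L = "\<lambda>\<omega> w s. likelihood (card R) n (accuracies \<omega>) w s"
  let ?G = "\<lambda>p. indicator T p * posterior r p"
  let ?J = "\<lambda>s \<omega>. indicator {\<omega> \<in> space M. rbar \<omega> = s} \<omega> :: real"
  note T [measurable]
  have G: "?G \<in> borel_measurable (acc_space \<Otimes>\<^sub>M ans_space)" by measurable
  have bound: "\<bar>?G (accuracies \<omega>, w)\<bar> \<le> 1" if "\<omega> \<in> space M" for \<omega> w
    using posterior_range[OF that r, of w] by (auto simp: indicator_def)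
  have Gw: "(\<lambda>x. ?G (x, w)) \<in> borel_measurable acc_space" if "w \<in> ?W" for w
    by (rule measurable_compose[OF measurable_Pair2' G]) (use that in \<open>simp add: space_PiM\<close>)
  \<comment> \<open>The joint law is available only with \<open>rbar\<close> fixed, hence the
    insertion of 1 as the sum of the indicators of \<open>rbar = s\<close>.\<close>
  have "expectation (\<lambda>\<omega>. ?G (accuracies \<omega>, answers \<omega>)) =
      expectation (\<lambda>\<omega>. \<Sum>s\<in>R. ?G (accuracies \<omega>, answers \<omega>) * ?J s \<omega>)"
  proof (rule Bochner_Integration.integral_cong)
    fix \<omega> assume \<omega>: "\<omega> \<in> space M"
    have "(\<Sum>s\<in>R. ?J s \<omega>) = (\<Sum>s\<in>R. if s = rbar \<omega> then 1 else 0)"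
      using \<omega> by (intro sum.cong) (auto simp: indicator_def)
    then have "(\<Sum>s\<in>R. ?J s \<omega>) = 1"
      using rbar_in[OF \<omega>] finite_answers by simp
    then show "?G (accuracies \<omega>, answers \<omega>) = (\<Sum>s\<in>R. ?G (accuracies \<omega>, answers \<omega>) * ?J s \<omega>)"
      by (simp flip: sum_distrib_left)
  qed simp
  also have "\<dots> = (\<Sum>s\<in>R. expectation (\<lambda>\<omega>. ?G (accuracies \<omega>, answers \<omega>) * ?J s \<omega>))"
  proof (rule Bochner_Integration.integral_sum)
    fix s
    have "\<bar>?G (accuracies \<omega>, answers \<omega>) * ?J s \<omega>\<bar> \<le> 1" if "\<omega> \<in> space M" for \<omega>
      using bound[OF that, of "answers \<omega>"] by (auto simp: indicator_def)
    then show "integrable M (\<lambda>\<omega>. ?G (accuracies \<omega>, answers \<omega>) * ?J s \<omega>)"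
      using measurable_compose[OF _ G, of "\<lambda>\<omega>. (accuracies \<omega>, answers \<omega>)" M]
      by (intro integrable_const_bound[where B=1] borel_measurable_times AE_I2) auto
  qed
  also have "\<dots> = (\<Sum>s\<in>R. (\<Sum>w\<in>?W. expectation (\<lambda>\<omega>. ?G (accuracies \<omega>, w) * ?L \<omega> w s)) / real (card R))"
    using bound by (intro sum.cong refl expectation_correct[OF G, where B=1]) auto
  also have "\<dots> = (\<Sum>w\<in>?W. \<Sum>s\<in>R. expectation (\<lambda>\<omega>. ?G (accuracies \<omega>, w) * ?L \<omega> w s)) / real (card R)"
    by (subst sum.swap) (simp add: sum_divide_distrib)
  also have "\<dots> = (\<Sum>w\<in>?W. expectation (\<lambda>\<omega>. indicator T (accuracies \<omega>, w) * ?L \<omega> w r)) / real (card R)"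
  proof (intro arg_cong2[where f="(/)"] sum.cong refl)
    fix w assume w: "w \<in> ?W"
    have "(\<Sum>s\<in>R. expectation (\<lambda>\<omega>. ?G (accuracies \<omega>, w) * ?L \<omega> w s)) =
        expectation (\<lambda>\<omega>. \<Sum>s\<in>R. ?G (accuracies \<omega>, w) * ?L \<omega> w s)"
    proof (rule Bochner_Integration.integral_sum[symmetric])
      fix s
      have "\<bar>?G (accuracies \<omega>, w)\<bar> * \<bar>?L \<omega> w s\<bar> \<le> 1 * 1" if "\<omega> \<in> space M" for \<omega>
        using bound[OF that, of w] likelihood_accuracies[OF that, of w s]
        by (intro mult_mono) auto
      then show "integrable M (\<lambda>\<omega>. ?G (accuracies \<omega>, w) * ?L \<omega> w s)"
        using measurable_compose[OF accuracies_measurable Gw[OF w]]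
        by (intro integrable_const_bound[where B=1] borel_measurable_times[of "\<lambda>\<omega>. ?G (accuracies \<omega>, w)"] AE_I2)
          (auto simp: abs_mult)
    qed
    also have "\<dots> = expectation (\<lambda>\<omega>. indicator T (accuracies \<omega>, w) * ?L \<omega> w r)"
    proof (rule Bochner_Integration.integral_cong)
      fix \<omega> assume \<omega>: "\<omega> \<in> space M"
      show "(\<Sum>s\<in>R. ?G (accuracies \<omega>, w) * ?L \<omega> w s) = indicator T (accuracies \<omega>, w) * ?L \<omega> w r"
        using sum_likelihood_pos[OF \<omega>, of w]
        unfolding sum_distrib_left[symmetric] by (simp add: posterior_def)
    qed simp
    finally show "(\<Sum>s\<in>R. expectation (\<lambda>\<omega>. ?G (accuracies \<omega>, w) * ?L \<omega> w s)) =
        expectation (\<lambda>\<omega>. indicator T (accuracies \<omega>, w) * ?L \<omega> w r)" .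
  qed
  \<comment> \<open>The joint law again, read from right to left for the indicator of
    \<open>T\<close>.\<close>
  also have "\<dots> = expectation (\<lambda>\<omega>. indicator T (accuracies \<omega>, answers \<omega>) * ?J r \<omega>)"
    using T r by (intro expectation_correct[symmetric, where B=1]) (auto simp: indicator_def)
  finally show ?thesis .
qed

text \<open>The posterior is measurable for the observed algebra, and every event of that algebra is
  the preimage of some \<open>T\<close> under the observation map; so
  \<open>expectation_posterior\<close> is exactly the characterisation of the conditional
  expectation.\<close>

lemma real_cond_exp_correct:
  assumes r: "r \<in> R"
  shows "AE \<omega> in M. real_cond_exp M (observed_algebra M R n a f)
      (indicator {\<omega> \<in> space M. rbar \<omega> = r}) \<omega> = posterior r (accuracies \<omega>, answers \<omega>)"
proof -
  let ?F = "observed_algebra M R n a f"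
  interpret F: finite_measure_subalgebra M ?F by (rule observed_subalgebra)
  have post: "(\<lambda>\<omega>. posterior r (accuracies \<omega>, answers \<omega>)) \<in> borel_measurable ?F"
    by (rule measurable_compose[OF observed_measurable posterior_measurable])
  show ?thesis
  proof (rule F.real_cond_exp_charact[OF _ _ _ post])
    fix S assume "S \<in> sets ?F"
    then obtain T where T: "T \<in> sets (acc_space \<Otimes>\<^sub>M ans_space)"
      and S: "S = (\<lambda>\<omega>. (accuracies \<omega>, answers \<omega>)) -` T \<inter> space M"
      unfolding observed_algebra_def accuracies_def answers_def
      using measurable_space[OF answer_rv]
      by (subst (asm) sets_vimage_algebra2) (auto simp: space_pair_measure space_PiM)
    have "set_lebesgue_integral M S g =
        expectation (\<lambda>\<omega>. indicator T (accuracies \<omega>, answers \<omega>) * g \<omega>)" for g :: "'w \<Rightarrow> real"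
      unfolding set_lebesgue_integral_def S
      by (intro Bochner_Integration.integral_cong) (auto simp: indicator_def)
    then show "set_lebesgue_integral M S (indicator {\<omega> \<in> space M. rbar \<omega> = r}) =
        (LINT \<omega>:S|M. posterior r (accuracies \<omega>, answers \<omega>))"
      using expectation_posterior[OF T r] by simp
  next
    show "integrable M (indicator {\<omega> \<in> space M. rbar \<omega> = r} :: _ \<Rightarrow> real)"
      by (rule integrable_const_bound[where B=1]) (auto simp: indicator_def)
    show "integrable M (\<lambda>\<omega>. posterior r (accuracies \<omega>, answers \<omega>))"
      using posterior_range[OF _ r]
      by (intro integrable_const_bound[where B=1]) auto
  qed
qed

section \<open>Probability that the correct answer has a majority\<close>

text \<open>For each \<open>r\<close>, the joint law and \<open>sum_likelihood_majority\<close> give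
  the event that \<open>r\<close> is correct and has a majority the same probability, namely the
  left-hand side divided by \<open>card R\<close>.\<close>

lemma expectation_majority_prob:
  "expectation (\<lambda>\<omega>. majority_prob n (\<lambda>j. a j \<omega>)) =
    (\<Sum>r\<in>R. expectation (\<lambda>\<omega>. of_bool (majority n (answers \<omega>) r) *
      indicator {\<omega> \<in> space M. rbar \<omega> = r} \<omega>))"
proof -
  let ?W = "{1..n} \<rightarrow>\<^sub>E R"
  let ?L = "\<lambda>\<omega> w s. likelihood (card R) n (accuracies \<omega>) w s"
  have "expectation (\<lambda>\<omega>. of_bool (majority n (answers \<omega>) r) * indicator {\<omega> \<in> space M. rbar \<omega> = r} \<omega>) =
      expectation (\<lambda>\<omega>. majority_prob n (\<lambda>j. a j \<omega>)) / real (card R)" if r: "r \<in> R" for r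
  proof -
    have "expectation (\<lambda>\<omega>. of_bool (majority n (answers \<omega>) r) * indicator {\<omega> \<in> space M. rbar \<omega> = r} \<omega>) =
       (\<Sum>w\<in>?W. expectation (\<lambda>\<omega>. of_bool (majority n w r) * ?L \<omega> w r)) / real (card R)"
      using expectation_correct[of "\<lambda>p. of_bool (majority n (snd p) r)" 1 r] r majority_measurable
      by simp
    also have "(\<Sum>w\<in>?W. expectation (\<lambda>\<omega>. of_bool (majority n w r) * ?L \<omega> w r)) =
        expectation (\<lambda>\<omega>. \<Sum>w\<in>?W. of_bool (majority n w r) * ?L \<omega> w r)"
    proof (rule Bochner_Integration.integral_sum[symmetric])
      fix w
      have "\<bar>of_bool (majority n w r) * ?L \<omega> w r\<bar> \<le> 1" if "\<omega> \<in> space M" for \<omega>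
        using likelihood_accuracies[OF that, of w r] by auto
      then show "integrable M (\<lambda>\<omega>. of_bool (majority n w r) * ?L \<omega> w r)"
        by (intro integrable_const_bound[where B=1]) auto
    qed
    also have "\<dots> = expectation (\<lambda>\<omega>. majority_prob n (\<lambda>j. a j \<omega>))"
    proof (rule Bochner_Integration.integral_cong)
      fix \<omega>
      have "(\<Sum>w\<in>?W. of_bool (majority n w r) * ?L \<omega> w r) =
          (\<Sum>w | w \<in> ?W \<and> majority n w r. likelihood (card R) n (\<lambda>j. a j \<omega>) w r)"
        unfolding sum.inter_filter[OF finite_profiles] accuracies_def
        by (auto intro!: sum.cong likelihood_cong)
      then show "(\<Sum>w\<in>?W. of_bool (majority n w r) * ?L \<omega> w r) = majority_prob n (\<lambda>j. a j \<omega>)"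
        using sum_likelihood_majority[OF finite_answers two_answers r] by simp
    qed simp
    finally show ?thesis .
  qed
  then show ?thesis using two_answers by simp
qed

end

section \<open>The returned result compared with the majority answer\<close>

context verification_result
begin

text \<open>Conditional independence factors the conditional probability of \<open>res = r\<close>
  and \<open>rbar = r\<close>, and the factor for \<open>rbar\<close> is the posterior. Summing over
  \<open>r\<close> evaluates the posterior at the returned answer.\<close>

lemma prob_correct:
  "prob {\<omega> \<in> space M. res \<omega> = rbar \<omega>} =
    expectation (\<lambda>\<omega>. posterior (res \<omega>) (accuracies \<omega>, answers \<omega>))"
proof -
  let ?F = "observed_algebra M R n a f"
  let ?A = "\<lambda>r. {\<omega> \<in> space M. res \<omega> = r}"
  let ?B = "\<lambda>r. {\<omega> \<in> space M. rbar \<omega> = r}"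
  let ?C = "\<lambda>r. {\<omega> \<in> space M. res \<omega> = r \<and> rbar \<omega> = r}"
  let ?q = "\<lambda>r \<omega>. posterior r (accuracies \<omega>, answers \<omega>)"
  note result_rv [measurable]
  interpret F: finite_measure_subalgebra M ?F by (rule observed_subalgebra)
  have q: "?q r \<in> borel_measurable ?F" for r
    by (rule measurable_compose[OF observed_measurable posterior_measurable])
  have res: "res \<omega> \<in> R" if "\<omega> \<in> space M" for \<omega>
    using measurable_space[OF result_rv that] by simp
  have meas [measurable]: "?A r \<in> sets M" "?C r \<in> sets M" if "r \<in> R" for r
    using that by measurable
  have int: "integrable M (\<lambda>\<omega>. ?q r \<omega> * indicator (?A r) \<omega>)" if r: "r \<in> R" for r
  proof (rule integrable_const_bound[where B=1])
    show "AE \<omega> in M. norm (?q r \<omega> * indicator (?A r) \<omega>) \<le> 1"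
      using posterior_range[OF _ r] by (auto simp: indicator_def)
  qed (use meas[OF r] in measurable)
  have eq: "prob (?C r) = expectation (\<lambda>\<omega>. ?q r \<omega> * indicator (?A r) \<omega>)" if r: "r \<in> R" for r
  proof -
    have "prob (?C r) = expectation (indicator (?C r))"
      using meas[OF r] by simp
    also have "\<dots> = expectation (real_cond_exp M ?F (indicator (?C r)))"
      using meas[OF r]
      by (intro F.real_cond_exp_int(2)[symmetric] integrable_real_indicator) (auto simp: emeasure_eq_measure)
    also have "\<dots> = expectation (\<lambda>\<omega>. ?q r \<omega> * real_cond_exp M ?F (indicator (?A r)) \<omega>)"
    proof (rule integral_cong_AE)
      show "AE \<omega> in M. real_cond_exp M ?F (indicator (?C r)) \<omega> =
          ?q r \<omega> * real_cond_exp M ?F (indicator (?A r)) \<omega>"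
        using result_cond_indep[OF r r] real_cond_exp_correct[OF r] by eventually_elim simp
    qed measurable
    \<comment> \<open>The posterior is measurable for the observed algebra, so under the expectation
      the conditional probability of \<open>res = r\<close> may be exchanged for the indicator
      itself.\<close>
    also have "\<dots> = expectation (\<lambda>\<omega>. ?q r \<omega> * indicator (?A r) \<omega>)"
      using int[OF r] q meas[OF r] by (intro F.real_cond_exp_intg(2)) auto
    finally show ?thesis .
  qed
  have "{\<omega> \<in> space M. res \<omega> = rbar \<omega>} = (\<Union>r\<in>R. ?C r)" using rbar_in by auto
  then have "prob {\<omega> \<in> space M. res \<omega> = rbar \<omega>} = (\<Sum>r\<in>R. prob (?C r))"
    using finite_answers meas(2)
    by (simp only:) (intro finite_measure_finite_Union, auto simp: disjoint_family_on_def)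
  also have "\<dots> = expectation (\<lambda>\<omega>. \<Sum>r\<in>R. ?q r \<omega> * indicator (?A r) \<omega>)"
    using int eq by (simp add: Bochner_Integration.integral_sum)
  also have "\<dots> = expectation (\<lambda>\<omega>. ?q (res \<omega>) \<omega>)"
  proof (rule Bochner_Integration.integral_cong)
    fix \<omega> assume \<omega>: "\<omega> \<in> space M"
    have "(\<Sum>r\<in>R. ?q r \<omega> * indicator (?A r) \<omega>) = (\<Sum>r\<in>R. if r = res \<omega> then ?q r \<omega> else 0)"
      using \<omega> by (intro sum.cong) (auto simp: indicator_def)
    then show "(\<Sum>r\<in>R. ?q r \<omega> * indicator (?A r) \<omega>) = ?q (res \<omega>) \<omega>"
      using res[OF \<omega>] finite_answers by simp
  qed simp
  finally show ?thesis .
qed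

text \<open>The left-hand side is the expected posterior of the majority answer, counted as 0 if
  there is none. The returned answer maximises the posterior at every point, so the comparison is
  pointwise.\<close>

lemma majority_prob_le_prob_correct:
  "expectation (\<lambda>\<omega>. majority_prob n (\<lambda>j. a j \<omega>)) \<le> prob {\<omega> \<in> space M. res \<omega> = rbar \<omega>}"
proof -
  let ?q = "\<lambda>r \<omega>. posterior r (accuracies \<omega>, answers \<omega>)"
  let ?b = "\<lambda>r \<omega>. of_bool (majority n (answers \<omega>) r) :: real"
  have res: "res \<omega> \<in> R" if "\<omega> \<in> space M" for \<omega>
    using measurable_space[OF result_rv that] by simp
  have max: "?q r \<omega> \<le> ?q (res \<omega>) \<omega>" if "\<omega> \<in> space M" "r \<in> R" for r \<omega>
    using result_highest[OF that(1)] that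
    by (simp add: posterior_eq_answer_confidence is_arg_max_linorder)
  have int: "integrable M (\<lambda>\<omega>. ?b r \<omega> * ?q r \<omega>)" if r: "r \<in> R" for r
    using posterior_range[OF _ r] majority_measurable
    by (intro integrable_const_bound[where B=1]) auto
  have "expectation (\<lambda>\<omega>. majority_prob n (\<lambda>j. a j \<omega>)) =
      (\<Sum>r\<in>R. expectation (\<lambda>\<omega>. ?b r \<omega> * indicator {\<omega> \<in> space M. rbar \<omega> = r} \<omega>))"
    by (rule expectation_majority_prob)
  also have "\<dots> = (\<Sum>r\<in>R. expectation (\<lambda>\<omega>. ?b r \<omega> * ?q r \<omega>))"
  proof (rule sum.cong)
    fix r assume r: "r \<in> R"
    \<comment> \<open>The majority of \<open>r\<close> depends on the observation only, so it can
      serve as the test event of \<open>expectation_posterior\<close>.\<close>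
    let ?T = "{p \<in> space (acc_space \<Otimes>\<^sub>M ans_space). majority n (snd p) r}"
    have T: "?T \<in> sets (acc_space \<Otimes>\<^sub>M ans_space)" using majority_measurable by measurable
    have "indicator ?T (accuracies \<omega>, answers \<omega>) = ?b r \<omega>" if "\<omega> \<in> space M" for \<omega>
      using measurable_space[OF accuracies_measurable that] measurable_space[OF answers_measurable that]
      by (auto simp: indicator_def space_pair_measure)
    then show "expectation (\<lambda>\<omega>. ?b r \<omega> * indicator {\<omega> \<in> space M. rbar \<omega> = r} \<omega>) =
        expectation (\<lambda>\<omega>. ?b r \<omega> * ?q r \<omega>)"
      using expectation_posterior[OF T r]
      by (simp cong: Bochner_Integration.integral_cong)
  qed simp
  also have "\<dots> = expectation (\<lambda>\<omega>. \<Sum>r\<in>R. ?b r \<omega> * ?q r \<omega>)"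
    using int by (simp add: Bochner_Integration.integral_sum)
  also have "\<dots> \<le> expectation (\<lambda>\<omega>. ?q (res \<omega>) \<omega>)"
  proof (rule integral_mono)
    show "integrable M (\<lambda>\<omega>. \<Sum>r\<in>R. ?b r \<omega> * ?q r \<omega>)" using int by simp
    have "?q r \<in> borel_measurable M" for r by measurable
    \<comment> \<open>The index \<open>res\<close> is random but takes values in a finite set, which
      keeps the composition measurable.\<close>
    then have "(\<lambda>\<omega>. ?q (res \<omega>) \<omega>) \<in> borel_measurable M"
      by (rule measurable_compose_countable'[where f="?q", OF _ result_rv])
        (rule countable_finite[OF finite_answers])
    then show "integrable M (\<lambda>\<omega>. ?q (res \<omega>) \<omega>)"
      using posterior_range res by (intro integrable_const_bound[where B=1]) auto
    fix \<omega> assume \<omega>: "\<omega> \<in> space M"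
    show "(\<Sum>r\<in>R. ?b r \<omega> * ?q r \<omega>) \<le> ?q (res \<omega>) \<omega>"
    proof (cases "\<exists>s\<in>R. majority n (answers \<omega>) s")
      case True
      then obtain s where s: "s \<in> R" "majority n (answers \<omega>) s" by blast
      \<comment> \<open>Here oddness of \<open>n\<close> enters: a single summand survives, and the
        maximal posterior bounds it.\<close>
      have "majority n (answers \<omega>) r \<longleftrightarrow> r = s" for r
        using s(2) majority_unique[OF odd_workers _ s(2), of r] by blast
      then have "(\<Sum>r\<in>R. ?b r \<omega> * ?q r \<omega>) = (\<Sum>r\<in>R. if r = s then ?q r \<omega> else 0)"
        by (intro sum.cong) simp_all
      then show ?thesis using max[OF \<omega> s(1)] s(1) finite_answers by simp
    next
      case False
      then have "(\<Sum>r\<in>R. ?b r \<omega> * ?q r \<omega>) = 0" by (intro sum.neutral) auto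
      then show ?thesis using posterior_range(1)[OF \<omega> res[OF \<omega>]] by simp
    qed
  qed
  also have "\<dots> = prob {\<omega> \<in> space M. res \<omega> = rbar \<omega>}" by (rule prob_correct[symmetric])
  finally show ?thesis .
qed

end

theorem theorem4:
  fixes M :: "'w measure" and R :: "'r set" and n :: nat and \<mu> C :: real
    and a :: "nat \<Rightarrow> 'w \<Rightarrow> real" and rbar :: "'w \<Rightarrow> 'r"
    and f :: "nat \<Rightarrow> 'w \<Rightarrow> 'r" and res :: "'w \<Rightarrow> 'r"
  assumes "verification_result M R n \<mu> a rbar f res"
    and "prob_space.expectation M (\<lambda>\<omega>. majority_prob n (\<lambda>j. a j \<omega>)) \<ge> C"
  shows "prob_space.prob M {\<omega> \<in> space M. res \<omega> = rbar \<omega>} \<ge> C"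
  using verification_result.majority_prob_le_prob_correct[OF assms(1)] assms(2) by linarith

end
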